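(* Let $R>3$ be a fixed real number. Then there does not exist $a\in(0,1/2)$ such that the sequence $n^a$ determines the rate of the moment convergence for all odd moments $r=2k+1<R$ and for all models in $\mathcal{LM}(R)$. That is, there is no $a\in(0,1/2)$ with the property that, for every model in $\mathcal{LM}(R)$, every admissible normalization $\mathbf{\Gamma}_n$ of it with associated matrix $\mathbf{V}$, every $\boldsymbol{\alpha}\in\mathbb{R}^p$, and every odd positive integer $r<R$, $$\mathbb{E}(\xi_n^r)-\mathbb{E}(\xi^r)=O(n^{-a})\quad\text{as } n\to\infty,$$ where $\xi_n=\boldsymbol{\alpha}^T\mathbf{\Gamma}_n(\boldsymbol{b}_n-\boldsymbol{\beta})$ and $\xi\sim N(0,\sigma^2\boldsymbol{\alpha}^T\mathbf{V}\boldsymbol{\alpha})$.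
   Context: Linear regression model. Fix an integer $p\ge1$, a parameter $\boldsymbol{\beta}\in\mathbb{R}^p$, a sequence of nonrandom vectors $\boldsymbol{x}_1,\boldsymbol{x}_2,\ldots\in\mathbb{R}^p$, and independent (not necessarily identically distributed) real random variables $\varepsilon_1,\varepsilon_2,\ldots$ with $\mathbb{E}(\varepsilon_i)=0$, $\mathrm{Var}(\varepsilon_i)=\sigma^2<\infty$ (the same for all $i$), and distribution functions $F_i$. For each $n$ let $\mathbf{X}_n=(\boldsymbol{x}_1,\ldots,\boldsymbol{x}_n)^T\in\mathbb{R}^{n\times p}$ and $\boldsymbol{Y}=\mathbf{X}_n\boldsymbol{\beta}+(\varepsilon_1,\ldots,\varepsilon_n)^T$. When $\mathrm{rank}(\mathbf{X}_n)=p$ the ordinary least squares estimator is $\boldsymbol{b}_n=(\mathbf{X}_n^T\mathbf{X}_n)^{-1}\mathbf{X}_n^T\boldsymbol{Y}$. Put $\mathbf{M}_n=(m_{ij;n})=\mathbf{X}_n^T\mathbf{X}_n$ and $\mathbf{D}_n=\mathrm{diag}(\sqrt{m_{11;n}},\ldots,\sqrt{m_{pp;n}})$; let $x_{i;n}$ denote the $i$-th component of $\boldsymbol{x}_n$. Assumptions: (i) $m_{ii;n}\to\infty$ as $n\to\infty$, $i=1,\ldots,p$; (ii) $x_{i;n+1}^2/m_{ii;n}\to0$ as $n\to\infty$, $i=1,\ldots,p$; (iii) $\mathbf{D}_n^{-1}\mathbf{M}_n\mathbf{D}_n^{-1}\to\mathbf{V}^{-1}$ as $n\to\infty$, with $\mathbf{V}^{-1}$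 nonsingular; (iii$'$) $n^{-1}\mathbf{X}_n^T\mathbf{X}_n\to\mathbf{V}^{-1}$ as $n\to\infty$, with $\mathbf{V}^{-1}\in\mathbb{R}^{p\times p}$ nonsingular; (iv) $\sup_{i\ge1}\int_{|u|>c}u^2\,dF_i(u)\to0$ as $c\to\infty$. For $R>0$, $\mathcal{LM}(R)$ is the family of such models (over all $p$, $\boldsymbol{\beta}$, design vectors and error distributions) for which either (i)–(iv) hold or (iii$'$) and (iv) hold, and $\sup_{i\ge1}\mathbb{E}|\varepsilon_i|^R<\infty$. Admissible normalization: $\mathbf{\Gamma}_n=\mathbf{D}_n$ if (i)–(iv) hold, with $\mathbf{V}$ from (iii); or $\mathbf{\Gamma}_n=\sqrt{n}\,\mathbf{I}_p$ if (iii$'$), (iv) hold, with $\mathbf{V}$ from (iii$'$). In either case $\mathbf{X}_n$ has rank $p$ for all sufficiently large $n$, and sequences indexed by $n$ are considered for those $n$ with $\mathrm{rank}(\mathbf{X}_n)=p$. It is known that $\mathbf{\Gamma}_n(\boldsymbol{b}_n-\boldsymbol{\beta})$ converges in distribution to $N_p(\boldsymbol{0},\sigma^2\mathbf{V})$. *)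

theory Defs
  imports
    "HOL-Probability.Probability"
    "HOL-Library.Landau_Symbols"
    "Jordan_Normal_Form.Gauss_Jordan_Elimination"
    "Jordan_Normal_Form.DL_Rank"
begin

text \<open>
  The dimension \<open>p\<close> varies from model to model, so vectors and matrices are those of
  \<^theory>\<open>Jordan_Normal_Form.Matrix\<close>, whose dimensions are natural numbers.
  Design vectors, errors and components are indexed from 0: \<open>x i\<close> and \<open>\<epsilon> i\<close> stand for
  $x_{i+1}$ and $\varepsilon_{i+1}$.
  The errors enter only through their joint law, so sample spaces with underlying type
  \<open>nat \<Rightarrow> real\<close> realise all models.
\<close>

subsection \<open>The regression model\<close>

locale regression_model = prob_space M
  for M :: "'w measure" +
  fixes p :: nat and \<beta> :: "real Matrix.vec" and x :: "nat \<Rightarrow> real Matrix.vec"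
    and \<epsilon> :: "nat \<Rightarrow> 'w \<Rightarrow> real" and \<sigma> :: real
  assumes dim_pos: "p \<ge> 1"
    and beta_carrier: "\<beta> \<in> carrier_vec p"
    and design_carrier: "\<And>i. x i \<in> carrier_vec p"
    and indep_errors: "indep_vars (\<lambda>_. borel) \<epsilon> UNIV"
    and errors_integrable: "\<And>i. integrable M (\<epsilon> i)"
    and errors_square_integrable: "\<And>i. integrable M (\<lambda>\<omega>. (\<epsilon> i \<omega>)\<^sup>2)"
    and errors_mean: "\<And>i. expectation (\<epsilon> i) = 0"
    and errors_variance: "\<And>i. variance (\<epsilon> i) = \<sigma>\<^sup>2"

definition design_mat :: "nat \<Rightarrow> (nat \<Rightarrow> real Matrix.vec) \<Rightarrow> nat \<Rightarrow> real mat" where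
  "design_mat p x n = mat_of_rows p (map x [0..<n])"

definition gram_mat :: "nat \<Rightarrow> (nat \<Rightarrow> real Matrix.vec) \<Rightarrow> nat \<Rightarrow> real mat" where
  "gram_mat p x n = transpose_mat (design_mat p x n) * design_mat p x n"

definition scale_mat :: "nat \<Rightarrow> (nat \<Rightarrow> real Matrix.vec) \<Rightarrow> nat \<Rightarrow> real mat" where
  "scale_mat p x n = mat_diag p (\<lambda>i. sqrt (gram_mat p x n $$ (i, i)))"

text \<open>Unspecified for singular matrices.\<close>

definition mat_inv :: "real mat \<Rightarrow> real mat" where
  "mat_inv A = the (mat_inverse A)"

lemma mat_inv_inverse:
  assumes A: "A \<in> carrier_mat n n" and inv: "invertible_mat A"
  shows "mat_inv A \<in> carrier_mat n n" "A * mat_inv A = 1\<^sub>m n" "mat_inv A * A = 1\<^sub>m n"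
proof -
  from inv obtain B where AB: "A * B = 1\<^sub>m (dim_row A)" and BA: "B * A = 1\<^sub>m (dim_row B)"
    unfolding invertible_mat_def inverts_mat_def by auto
  have "dim_col B = n" using arg_cong[OF AB, of dim_col] A by simp
  moreover have "dim_row B = n" using arg_cong[OF BA, of dim_col] A by simp
  ultimately have "B \<in> carrier_mat n n" by auto
  hence "A \<in> Units (ring_mat TYPE(real) n ())"
    using A AB BA unfolding Units_def ring_mat_def by auto
  then obtain C where "mat_inverse A = Some C"
    using mat_inverse(1)[OF A, of "()"] by (cases "mat_inverse A") auto
  with mat_inverse(2)[OF A this]
  show "mat_inv A \<in> carrier_mat n n" "A * mat_inv A = 1\<^sub>m n" "mat_inv A * A = 1\<^sub>m n"
    by (auto simp: mat_inv_def)
qed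

definition response ::
  "nat \<Rightarrow> real Matrix.vec \<Rightarrow> (nat \<Rightarrow> real Matrix.vec) \<Rightarrow> (nat \<Rightarrow> 'w \<Rightarrow> real) \<Rightarrow> nat \<Rightarrow> 'w \<Rightarrow> real Matrix.vec"
  where "response p \<beta> x \<epsilon> n \<omega> =
    design_mat p x n *\<^sub>v \<beta> + Matrix.vec n (\<lambda>i. \<epsilon> i \<omega>)"

text \<open>Meaningful only for those \<open>n\<close> with \<open>full_rank p x n\<close>.\<close>

definition ols ::
  "nat \<Rightarrow> real Matrix.vec \<Rightarrow> (nat \<Rightarrow> real Matrix.vec) \<Rightarrow> (nat \<Rightarrow> 'w \<Rightarrow> real) \<Rightarrow> nat \<Rightarrow> 'w \<Rightarrow> real Matrix.vec"
  where "ols p \<beta> x \<epsilon> n \<omega> =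
    mat_inv (gram_mat p x n) *\<^sub>v (transpose_mat (design_mat p x n) *\<^sub>v response p \<beta> x \<epsilon> n \<omega>)"

definition full_rank :: "nat \<Rightarrow> (nat \<Rightarrow> real Matrix.vec) \<Rightarrow> nat \<Rightarrow> bool" where
  "full_rank p x n \<longleftrightarrow> vec_space.rank n (design_mat p x n) = p"


subsection \<open>Assumptions on the design and on the errors\<close>

definition mat_tendsto :: "nat \<Rightarrow> (nat \<Rightarrow> real mat) \<Rightarrow> real mat \<Rightarrow> bool" where
  "mat_tendsto p A L \<longleftrightarrow> (\<forall>i<p. \<forall>j<p. (\<lambda>n. A n $$ (i, j)) \<longlonglongrightarrow> L $$ (i, j))"

definition cond_i :: "nat \<Rightarrow> (nat \<Rightarrow> real Matrix.vec) \<Rightarrow> bool" where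
  "cond_i p x \<longleftrightarrow> (\<forall>i<p. filterlim (\<lambda>n. gram_mat p x n $$ (i, i)) at_top sequentially)"

text \<open>By the index shift, \<open>x n\<close> is the first design vector that does not enter \<open>gram_mat p x n\<close>.\<close>

definition cond_ii :: "nat \<Rightarrow> (nat \<Rightarrow> real Matrix.vec) \<Rightarrow> bool" where
  "cond_ii p x \<longleftrightarrow>
    (\<forall>i<p. (\<lambda>n. (vec_index (x n) i)\<^sup>2 / gram_mat p x n $$ (i, i)) \<longlonglongrightarrow> 0)"

definition cond_iii :: "nat \<Rightarrow> (nat \<Rightarrow> real Matrix.vec) \<Rightarrow> real mat \<Rightarrow> bool" where
  "cond_iii p x V \<longleftrightarrow> V \<in> carrier_mat p p \<and> invertible_mat V \<and>
    mat_tendsto p (\<lambda>n. mat_inv (scale_mat p x n) * gram_mat p x n * mat_inv (scale_mat p x n))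
      (mat_inv V)"

definition cond_iii' :: "nat \<Rightarrow> (nat \<Rightarrow> real Matrix.vec) \<Rightarrow> real mat \<Rightarrow> bool" where
  "cond_iii' p x V \<longleftrightarrow> V \<in> carrier_mat p p \<and> invertible_mat V \<and>
    mat_tendsto p (\<lambda>n. (1 / real n) \<cdot>\<^sub>m gram_mat p x n) (mat_inv V)"

text \<open>The distribution function of an error enters through the law \<open>distr M borel (\<epsilon> i)\<close>.\<close>

definition cond_iv :: "'w measure \<Rightarrow> (nat \<Rightarrow> 'w \<Rightarrow> real) \<Rightarrow> bool" where
  "cond_iv M \<epsilon> \<longleftrightarrow>
    ((\<lambda>c::real. SUP i. \<integral>\<^sup>+ u. ennreal (u\<^sup>2) * indicator {u. \<bar>u\<bar> > c} u \<partial>(distr M borel (\<epsilon> i)))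
      \<longlongrightarrow> 0) at_top"

definition admissible ::
  "'w measure \<Rightarrow> nat \<Rightarrow> (nat \<Rightarrow> real Matrix.vec) \<Rightarrow> (nat \<Rightarrow> 'w \<Rightarrow> real)
    \<Rightarrow> (nat \<Rightarrow> real mat) \<Rightarrow> real mat \<Rightarrow> bool"
  where "admissible M p x \<epsilon> \<Gamma> V \<longleftrightarrow>
    (cond_i p x \<and> cond_ii p x \<and> cond_iii p x V \<and> cond_iv M \<epsilon> \<and> \<Gamma> = scale_mat p x) \<or>
    (cond_iii' p x V \<and> cond_iv M \<epsilon> \<and> \<Gamma> = (\<lambda>n. sqrt (real n) \<cdot>\<^sub>m 1\<^sub>m p))"

definition LM ::
  "real \<Rightarrow> 'w measure \<Rightarrow> nat \<Rightarrow> real Matrix.vec \<Rightarrow> (nat \<Rightarrow> real Matrix.vec)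
    \<Rightarrow> (nat \<Rightarrow> 'w \<Rightarrow> real) \<Rightarrow> real \<Rightarrow> bool"
  where "LM R M p \<beta> x \<epsilon> \<sigma> \<longleftrightarrow>
    regression_model M p \<beta> x \<epsilon> \<sigma> \<and>
    ((\<exists>V. cond_i p x \<and> cond_ii p x \<and> cond_iii p x V \<and> cond_iv M \<epsilon>) \<or>
     (\<exists>V. cond_iii' p x V \<and> cond_iv M \<epsilon>)) \<and>
    (SUP i. \<integral>\<^sup>+ \<omega>. ennreal (\<bar>\<epsilon> i \<omega>\<bar> powr R) \<partial>M) < \<infinity>"


subsection \<open>Moments and their limits\<close>

definition xi ::
  "nat \<Rightarrow> real Matrix.vec \<Rightarrow> (nat \<Rightarrow> real Matrix.vec) \<Rightarrow> (nat \<Rightarrow> 'w \<Rightarrow> real)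
    \<Rightarrow> (nat \<Rightarrow> real mat) \<Rightarrow> real Matrix.vec \<Rightarrow> nat \<Rightarrow> 'w \<Rightarrow> real"
  where "xi p \<beta> x \<epsilon> \<Gamma> \<alpha> n \<omega> =
    scalar_prod \<alpha> (\<Gamma> n *\<^sub>v (ols p \<beta> x \<epsilon> n \<omega> - \<beta>))"

text \<open>
  The centred normal law with variance \<open>v\<close>; variance 0, the point mass at 0, occurs for
  \<open>\<alpha> = 0\<close> and for \<open>\<sigma> = 0\<close>, and \<^const>\<open>normal_density\<close> does not cover it.
\<close>

definition centred_normal :: "real \<Rightarrow> real measure" where
  "centred_normal v =
    (if v = 0 then return borel 0 else density lborel (normal_density 0 (sqrt v)))"

definition full_rank_sequentially :: "nat \<Rightarrow> (nat \<Rightarrow> real Matrix.vec) \<Rightarrow> nat filter" where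
  "full_rank_sequentially p x = inf sequentially (principal {n. full_rank p x n})"

definition moment_rate ::
  "(nat \<Rightarrow> real) \<Rightarrow> 'w measure \<Rightarrow> nat \<Rightarrow> real Matrix.vec \<Rightarrow> (nat \<Rightarrow> real Matrix.vec)
    \<Rightarrow> (nat \<Rightarrow> 'w \<Rightarrow> real) \<Rightarrow> real \<Rightarrow> (nat \<Rightarrow> real mat) \<Rightarrow> real mat \<Rightarrow> real Matrix.vec \<Rightarrow> nat \<Rightarrow> bool"
  where "moment_rate g M p \<beta> x \<epsilon> \<sigma> \<Gamma> V \<alpha> r \<longleftrightarrow>
    (\<lambda>n. (\<integral>\<omega>. (xi p \<beta> x \<epsilon> \<Gamma> \<alpha> n \<omega>) ^ r \<partial>M)
        - (\<integral>y. y ^ r \<partial>(centred_normal (\<sigma>\<^sup>2 * scalar_prod \<alpha> (V *\<^sub>v \<alpha>)))))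
      \<in> O[full_rank_sequentially p x](g)"

end

theory Submission
  imports Defs "HOL-Real_Asymp.Real_Asymp"
begin

text \<open>
  In dimension one, take i.i.d. errors with values 2 and -1, mean 0 and third moment 2, and a
  design that equals 1 at the powers of two and 0 elsewhere.  The normalised estimation error is
  then a sum of $m_n$ errors divided by $\sqrt{m_n}$, where $m_n$ is the number of powers of two
  below $n$.  Its third moment is $2/\sqrt{m_n}$, of order $(\log n)^{-1/2}$, which is not
  $O(n^{-a})$ for any $a > 0$, whereas the third moment of the normal limit vanishes.
\<close>

text \<open>Keeps the dimension \<open>1\<close> from being rewritten to \<open>Suc 0\<close>, so
  that rules stated for dimension \<open>1\<close> keep matching.\<close>

declare One_nat_def [simp del]

section \<open>Third moments of sums of independent centred variables\<close>

text \<open>Third cumulants of independent variables add up, and for centred variables they are the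
  third moments. Integrability of the powers is carried through the induction because the mixed
  products in the next step need it.\<close>

lemma (in prob_space) third_moment_sum:
  fixes X :: "'i \<Rightarrow> 'a \<Rightarrow> real"
  assumes "finite I" and "indep_vars (\<lambda>_. borel) X I"
    and "\<And>i k. i \<in> I \<Longrightarrow> k \<le> 3 \<Longrightarrow> integrable M (\<lambda>\<omega>. X i \<omega> ^ k)"
    and "\<And>i. i \<in> I \<Longrightarrow> expectation (X i) = 0"
  shows "(\<forall>k\<le>3. integrable M (\<lambda>\<omega>. (\<Sum>i\<in>I. X i \<omega>) ^ k))
    \<and> expectation (\<lambda>\<omega>. \<Sum>i\<in>I. X i \<omega>) = 0
    \<and> expectation (\<lambda>\<omega>. (\<Sum>i\<in>I. X i \<omega>) ^ 3) = (\<Sum>i\<in>I. expectation (\<lambda>\<omega>. X i \<omega> ^ 3))"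
  using assms
proof (induction I rule: finite_induct)
  case empty
  then show ?case by (simp add: power_0_left)
next
  case (insert j I)
  define S where "S = (\<lambda>\<omega>. \<Sum>i\<in>I. X i \<omega>)"
  have sub: "indep_vars (\<lambda>_. borel) X I"
    using insert.prems(1) by (rule indep_vars_subset) auto
  have IH: "\<And>k. k \<le> 3 \<Longrightarrow> integrable M (\<lambda>\<omega>. S \<omega> ^ k)" "expectation S = 0"
    "expectation (\<lambda>\<omega>. S \<omega> ^ 3) = (\<Sum>i\<in>I. expectation (\<lambda>\<omega>. X i \<omega> ^ 3))"
    using insert.IH[OF sub] insert.prems by (auto simp: S_def)
  have Xj: "\<And>k. k \<le> 3 \<Longrightarrow> integrable M (\<lambda>\<omega>. X j \<omega> ^ k)" "expectation (X j) = 0"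
    using insert.prems by auto
  have "indep_var borel (X j) borel S"
    unfolding S_def using insert by (intro indep_vars_sum) auto
  then have ind: "indep_var borel (\<lambda>\<omega>. X j \<omega> ^ a) borel (\<lambda>\<omega>. S \<omega> ^ b)" for a b
    using indep_var_compose[of borel "X j" borel S "\<lambda>x. x ^ a" borel "\<lambda>x. x ^ b" borel]
    by (simp add: o_def)
  have int: "integrable M (\<lambda>\<omega>. X j \<omega> ^ a * S \<omega> ^ b)" if "a \<le> 3" "b \<le> 3" for a b
    using that by (intro indep_var_integrable ind Xj IH)
  have exp: "expectation (\<lambda>\<omega>. X j \<omega> ^ a * S \<omega> ^ b)
      = expectation (\<lambda>\<omega>. X j \<omega> ^ a) * expectation (\<lambda>\<omega>. S \<omega> ^ b)" if "a \<le> 3" "b \<le> 3" for a b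
    using that by (intro indep_var_lebesgue_integral ind Xj IH)
  \<comment> \<open>The binomial expansion leaves only monomials in \<open>X j\<close> and
    \<open>S\<close>, integrable by independence.\<close>
  have 1: "integrable M (\<lambda>\<omega>. (X j \<omega> + S \<omega>) ^ k)" if "k \<le> 3" for k
    unfolding binomial_ring mult.assoc using that
    by (intro Bochner_Integration.integrable_sum integrable_mult_right int) auto
  \<comment> \<open>Each mixed cubic term has a factor to the first power, whose mean is 0.\<close>
  have e12: "expectation (\<lambda>\<omega>. X j \<omega> * (S \<omega>)\<^sup>2) = 0"
    and e21: "expectation (\<lambda>\<omega>. (X j \<omega>)\<^sup>2 * S \<omega>) = 0"
    using exp[of 1 2] exp[of 2 1] Xj(2) IH(2) by simp_all
  have i12: "integrable M (\<lambda>\<omega>. X j \<omega> * (S \<omega>)\<^sup>2)"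
    and i21: "integrable M (\<lambda>\<omega>. (X j \<omega>)\<^sup>2 * S \<omega>)"
    using int[of 1 2] int[of 2 1] by simp_all
  have "expectation (\<lambda>\<omega>. (X j \<omega> + S \<omega>) ^ 3) = expectation (\<lambda>\<omega>. X j \<omega> ^ 3
      + (3 * ((X j \<omega>)\<^sup>2 * S \<omega>) + (3 * (X j \<omega> * (S \<omega>)\<^sup>2) + S \<omega> ^ 3)))"
    by (intro Bochner_Integration.integral_cong) (auto simp: algebra_simps power2_eq_square power3_eq_cube)
  also have "\<dots> = expectation (\<lambda>\<omega>. X j \<omega> ^ 3) + expectation (\<lambda>\<omega>. S \<omega> ^ 3)"
    using Xj(1)[of 3] IH(1)[of 3] i12 i21 e12 e21 by simp
  finally have 3: "expectation (\<lambda>\<omega>. (X j \<omega> + S \<omega>) ^ 3) = \<dots>" .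
  have 2: "expectation (\<lambda>\<omega>. X j \<omega> + S \<omega>) = 0"
    using Xj(1)[of 1] IH(1)[of 1] Xj(2) IH(2) by simp
  show ?case
    using 1 2 3 IH(3) insert.hyps by (simp add: S_def)
qed

section \<open>Rank and inverses for a single regressor\<close>

text \<open>The only column has a nonzero entry, and a single nonzero vector is linearly
  independent.\<close>

lemma full_rank_single_column:
  assumes "i < n" and "vec_index (x i) 0 \<noteq> 0" and x: "\<And>i. x i \<in> carrier_vec 1"
  shows "full_rank 1 x n"
proof -
  interpret vec_space "TYPE(real)" n .
  let ?A = "design_mat 1 x n"
  have A: "?A \<in> carrier_mat n 1"
    unfolding design_mat_def by auto
  have col: "col ?A 0 \<in> carrier_vec n"
    using col_dim[of ?A 0] A by simp
  have c: "cols ?A = [col ?A 0]"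
    using A by (simp add: cols_def One_nat_def)
  have "col ?A 0 $ i \<noteq> 0"
    using assms carrier_vecD[OF x] by (simp add: design_mat_def mat_of_rows_def)
  then have nz: "col ?A 0 \<noteq> 0\<^sub>v n"
    using \<open>i < n\<close> by auto
  have "lin_indpt {col ?A 0}"
  proof (rule finite_lin_indpt2)
    show "{col ?A 0} \<subseteq> carrier_vec n"
      using col by simp
    fix a assume "lincomb a {col ?A 0} = 0\<^sub>v n"
    then have "a (col ?A 0) \<cdot>\<^sub>v col ?A 0 = 0\<^sub>v n"
      using col by (simp add: lincomb_def)
    then have "vec_index (a (col ?A 0) \<cdot>\<^sub>v col ?A 0) i = 0"
      using \<open>i < n\<close> by simp
    then show "\<forall>v\<in>{col ?A 0}. a v = 0"
      using \<open>col ?A 0 $ i \<noteq> 0\<close> \<open>i < n\<close> carrier_vecD[OF col]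
      by (simp del: index_col)
  qed auto
  then show ?thesis
    unfolding full_rank_def using lin_indpt_full_rank[OF A] c by simp
qed

text \<open>By uniqueness of inverses, exhibiting a two-sided inverse evaluates
  \<open>mat_inv\<close> without running the elimination behind it.\<close>

lemma mat_inv_eqI:
  assumes A: "A \<in> carrier_mat n n" and B: "B \<in> carrier_mat n n"
    and AB: "A * B = 1\<^sub>m n" and BA: "B * A = 1\<^sub>m n"
  shows "mat_inv A = B"
proof -
  have inv: "invertible_mat A"
    unfolding invertible_mat_def inverts_mat_def using A B AB BA by auto
  note C = mat_inv_inverse[OF A inv]
  have "mat_inv A = mat_inv A * (A * B)"
    using AB C(1) by simp
  also have "\<dots> = B"
    using assoc_mult_mat[OF C(1) A B] C(3) B by simp
  finally show ?thesis .
qed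

lemma mat_inv_mat_1:
  assumes "c \<noteq> 0"
  shows "mat_inv (Matrix.mat 1 1 (\<lambda>_. c)) = Matrix.mat 1 1 (\<lambda>_. inverse c)"
  by (rule mat_inv_eqI[where n = 1])
     (use assms in \<open>auto simp: scalar_prod_def\<close>)

subsection \<open>Regression through the origin\<close>

abbreviation scalar_design :: "(nat \<Rightarrow> real) \<Rightarrow> nat \<Rightarrow> real Matrix.vec" where
  "scalar_design d i \<equiv> Matrix.vec 1 (\<lambda>_. d i)"

lemma design_mat_scalar_design:
  "design_mat 1 (scalar_design d) n = Matrix.mat n 1 (\<lambda>(i, _). d i)"
  by (rule eq_matI) (auto simp: design_mat_def mat_of_rows_def)

lemma gram_mat_scalar_design:
  "gram_mat 1 (scalar_design d) n = Matrix.mat 1 1 (\<lambda>_. \<Sum>i<n. (d i)\<^sup>2)"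
  unfolding gram_mat_def design_mat_scalar_design
  by (rule eq_matI) (auto simp: scalar_prod_def power2_eq_square atLeast0LessThan)

lemma scale_mat_scalar_design:
  "scale_mat 1 (scalar_design d) n = Matrix.mat 1 1 (\<lambda>_. sqrt (\<Sum>i<n. (d i)\<^sup>2))"
  by (rule eq_matI) (auto simp: scale_mat_def mat_diag_def gram_mat_scalar_design)

text \<open>For a zero parameter the response is the error vector, so least squares gives the
  weighted error sum divided by the Gram entry; the normalization restores a square root of that
  entry. Positivity makes the Gram matrix invertible.\<close>

lemma xi_scalar_design:
  assumes m: "(\<Sum>i<n. (d i)\<^sup>2) > 0"
  shows "xi 1 (0\<^sub>v 1) (scalar_design d) \<epsilon> (scale_mat 1 (scalar_design d)) (Matrix.vec 1 (\<lambda>_. 1)) n \<omega>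
    = (\<Sum>i<n. d i * \<epsilon> i \<omega>) / sqrt (\<Sum>i<n. (d i)\<^sup>2)"
proof -
  let ?m = "\<Sum>i<n. (d i)\<^sup>2" and ?S = "\<Sum>i<n. d i * \<epsilon> i \<omega>"
  have resp: "response 1 (0\<^sub>v 1) (scalar_design d) \<epsilon> n \<omega> = Matrix.vec n (\<lambda>i. \<epsilon> i \<omega>)"
    by (rule eq_vecI) (auto simp: response_def design_mat_scalar_design scalar_prod_def)
  have "ols 1 (0\<^sub>v 1) (scalar_design d) \<epsilon> n \<omega> = Matrix.vec 1 (\<lambda>_. inverse ?m * ?S)"
    using m unfolding ols_def resp gram_mat_scalar_design design_mat_scalar_design
    by (intro eq_vecI) (auto simp: mat_inv_mat_1 scalar_prod_def atLeast0LessThan)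
  then have "xi 1 (0\<^sub>v 1) (scalar_design d) \<epsilon> (scale_mat 1 (scalar_design d)) (Matrix.vec 1 (\<lambda>_. 1)) n \<omega>
      = sqrt ?m * (inverse ?m * ?S)"
    by (simp add: xi_def scale_mat_scalar_design scalar_prod_def)
  also have "\<dots> = ?S / sqrt ?m"
    using m by (simp add: field_simps)
  finally show ?thesis .
qed

text \<open>With one regressor the normalized Gram matrix is exactly 1 once the Gram entry is
  positive. The condition therefore puts no bound on how slowly that entry may grow.\<close>

lemma cond_iii_scalar_design:
  assumes "eventually (\<lambda>n. (\<Sum>i<n. (d i)\<^sup>2) > 0) sequentially"
  shows "cond_iii 1 (scalar_design d) (1\<^sub>m 1)"
proof -
  have inv1: "mat_inv (1\<^sub>m 1) = 1\<^sub>m 1"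
    by (rule mat_inv_eqI) auto
  have "eventually (\<lambda>n. (mat_inv (scale_mat 1 (scalar_design d) n) * gram_mat 1 (scalar_design d) n
      * mat_inv (scale_mat 1 (scalar_design d) n)) $$ (0, 0) = 1) sequentially"
    using assms
  proof eventually_elim
    case (elim n)
    let ?m = "\<Sum>i<n. (d i)\<^sup>2"
    have "(mat_inv (scale_mat 1 (scalar_design d) n) * gram_mat 1 (scalar_design d) n
      * mat_inv (scale_mat 1 (scalar_design d) n)) $$ (0, 0) = inverse (sqrt ?m) * ?m * inverse (sqrt ?m)"
      using elim by (simp add: scale_mat_scalar_design gram_mat_scalar_design mat_inv_mat_1 scalar_prod_def)
    also have "\<dots> = 1"
      using elim by (simp add: field_simps)
    finally show ?case .
  qed
  then show ?thesis
    unfolding cond_iii_def mat_tendsto_def inv1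
    by (auto intro!: tendsto_eventually exI[of _ "1\<^sub>m 1"] simp: invertible_mat_def inverts_mat_def)
qed

subsection \<open>A sparse design\<close>

text \<open>The powers of two are infinite in number, yet only logarithmically many lie below
  \<open>n\<close>, fewer than any positive power of \<open>n\<close>.\<close>

definition dyadic_indicator :: "nat \<Rightarrow> real" where
  "dyadic_indicator i = indicator (range (\<lambda>k. 2 ^ k)) i"

text \<open>The values are 0 and 1, so one count serves both as the Gram entry and as the total
  weight in the third moment.\<close>

lemma dyadic_indicator_power [simp]: "0 < k \<Longrightarrow> dyadic_indicator i ^ k = dyadic_indicator i"
  by (auto simp: dyadic_indicator_def indicator_def)

lemma sum_dyadic_indicator: "(\<Sum>i<2 ^ k. dyadic_indicator i) = real k"
proof -
  have "{i. i < 2 ^ k} \<inter> range (\<lambda>k. 2 ^ k) = (\<lambda>j. 2 ^ j :: nat) ` {..<k}"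
    by auto
  moreover have "inj_on (\<lambda>j. 2 ^ j :: nat) {..<k}"
    by (auto simp: inj_on_def)
  ultimately show ?thesis
    by (simp add: dyadic_indicator_def sum.inter_restrict [symmetric] indicator_def
      lessThan_def card_image sum.If_cases)
qed

text \<open>The partial sums are monotone, and their values at powers of two are unbounded.\<close>

lemma sum_dyadic_indicator_at_top:
  "filterlim (\<lambda>n. \<Sum>i<n. dyadic_indicator i) at_top sequentially"
  unfolding filterlim_at_top
proof
  fix Z :: real
  obtain k where k: "Z \<le> real k"
    using real_arch_simple by blast
  show "\<forall>\<^sub>F n in sequentially. Z \<le> (\<Sum>i<n. dyadic_indicator i)"
    using eventually_ge_at_top[of "2 ^ k"]
  proof eventually_elim
    case (elim n)
    then have "(\<Sum>i<2 ^ k. dyadic_indicator i) \<le> (\<Sum>i<n. dyadic_indicator i)"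
      by (intro sum_mono2) (auto simp: dyadic_indicator_def)
    then show ?case
      using k by (simp add: sum_dyadic_indicator)
  qed
qed

abbreviation dyadic_design :: "nat \<Rightarrow> real Matrix.vec" where
  "dyadic_design \<equiv> scalar_design dyadic_indicator"

lemma dyadic_design_conditions:
  "cond_i 1 dyadic_design" "cond_ii 1 dyadic_design" "cond_iii 1 dyadic_design (1\<^sub>m 1)"
proof -
  show "cond_i 1 dyadic_design"
    by (simp add: cond_i_def gram_mat_scalar_design sum_dyadic_indicator_at_top)
  \<comment> \<open>The indicator is at most 1, so this quotient dominates the one in (ii). This
    includes the initial \<open>n\<close> with empty count, where division by 0 makes both quotients
    0.\<close>
  have "((\<lambda>n. 1 / (\<Sum>i<n. dyadic_indicator i)) \<longlongrightarrow> 0) sequentially"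
    by (intro tendsto_divide_0[OF tendsto_const] filterlim_at_top_imp_at_infinity
      sum_dyadic_indicator_at_top)
  then have "(\<lambda>n. dyadic_indicator n / (\<Sum>i<n. dyadic_indicator i)) \<longlonglongrightarrow> 0"
    by (rule Lim_null_comparison[rotated])
       (auto intro!: always_eventually divide_right_mono sum_nonneg
         simp: dyadic_indicator_def indicator_def)
  then show "cond_ii 1 dyadic_design"
    by (simp add: cond_ii_def gram_mat_scalar_design)
  show "cond_iii 1 dyadic_design (1\<^sub>m 1)"
    using sum_dyadic_indicator_at_top
    by (intro cond_iii_scalar_design) (simp add: filterlim_at_top_dense)
qed

subsection \<open>Independent skewed errors\<close>

text \<open>The value 2 has probability 1/3 and -1 has probability 2/3: the mean is 0, while the
  asymmetry leaves a nonzero third moment. The variance is (4 + 2) / 3 = 2, whence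
  \<open>sqrt 2\<close> as the standard deviation below.\<close>

definition skewed_law :: "real measure" where
  "skewed_law = distr (bernoulli_pmf (1 / 3)) borel (\<lambda>b. if b then 2 else - 1)"

text \<open>The canonical sequence space: the errors are the coordinates, so their independence is
  built into the product measure.\<close>

definition error_space :: "(nat \<Rightarrow> real) measure" where
  "error_space = PiM UNIV (\<lambda>_. skewed_law)"

abbreviation (input) error :: "nat \<Rightarrow> (nat \<Rightarrow> real) \<Rightarrow> real" where
  "error i \<omega> \<equiv> \<omega> i"

lemma prob_space_skewed_law: "prob_space skewed_law"
  unfolding skewed_law_def by (intro prob_space.prob_space_distr prob_space_measure_pmf) simp

lemma sets_skewed_law [measurable_cong, simp]: "sets skewed_law = sets borel"
  by (simp add: skewed_law_def)

lemma prob_space_error_space: "prob_space error_space"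
  unfolding error_space_def by (intro prob_space_PiM prob_space_skewed_law)

lemma measurable_error [measurable]: "error i \<in> borel_measurable error_space"
proof -
  have "error i \<in> measurable error_space skewed_law"
    unfolding error_space_def by measurable
  then show ?thesis
    by (simp cong: measurable_cong_sets)
qed

lemma distr_error: "distr error_space borel (error i) = skewed_law"
proof -
  have "distr error_space skewed_law (error i) = skewed_law"
    unfolding error_space_def by (rule distr_PiM_component) (auto intro: prob_space_skewed_law)
  then show ?thesis
    by (simp cong: distr_cong)
qed

lemma indep_errors: "prob_space.indep_vars error_space (\<lambda>_. borel) error UNIV"
proof -
  interpret prob_space error_space
    by (rule prob_space_error_space)
  \<comment> \<open>The joint map is the identity, and \<open>skewed_law\<close> has the same
    measurable sets as \<open>borel\<close>, so the joint law is the product measure itself.\<close>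
  have "distr error_space (PiM UNIV (\<lambda>_. borel)) (\<lambda>\<omega>. \<lambda>i\<in>UNIV. error i \<omega>) = error_space"
    unfolding restrict_UNIV by (rule distr_id2) (auto simp: error_space_def intro!: sets_PiM_cong)
  then show ?thesis
    by (subst indep_vars_iff_distr_eq_PiM) (auto simp: distr_error error_space_def[symmetric])
qed

lemma integral_error:
  assumes [measurable]: "f \<in> borel_measurable borel"
  shows "integrable error_space (\<lambda>\<omega>. f (error i \<omega>) :: real)"
    and "(\<integral>\<omega>. f (error i \<omega>) \<partial>error_space) = f 2 / 3 + f (- 1) * 2 / 3"
proof -
  have "integrable (distr error_space borel (error i)) f"
    unfolding distr_error skewed_law_def
    by (subst integrable_distr_eq) (auto intro: integrable_measure_pmf_finite)
  then show "integrable error_space (\<lambda>\<omega>. f (error i \<omega>))"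
    by (simp add: integrable_distr_eq)
  have "(\<integral>\<omega>. f (error i \<omega>) \<partial>error_space) = (\<integral>u. f u \<partial>distr error_space borel (error i))"
    by (simp add: integral_distr)
  also have "\<dots> = f 2 / 3 + f (- 1) * 2 / 3"
    unfolding distr_error skewed_law_def by (subst integral_distr) auto
  finally show "(\<integral>\<omega>. f (error i \<omega>) \<partial>error_space) = f 2 / 3 + f (- 1) * 2 / 3" .
qed

lemma nn_integral_skewed_law:
  assumes [measurable]: "f \<in> borel_measurable borel"
  shows "(\<integral>\<^sup>+ u. f u \<partial>skewed_law) = f 2 * ennreal (1 / 3) + f (- 1) * ennreal (2 / 3)"
  unfolding skewed_law_def by (subst nn_integral_distr) auto

lemma nn_integral_error:
  assumes [measurable]: "f \<in> borel_measurable borel"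
  shows "(\<integral>\<^sup>+ \<omega>. f (error i \<omega>) \<partial>error_space) = f 2 * ennreal (1 / 3) + f (- 1) * ennreal (2 / 3)"
  using nn_integral_distr[OF measurable_error, of f i] assms
  by (simp add: distr_error nn_integral_skewed_law cong: measurable_cong_sets)

lemma cond_iv_error: "cond_iv error_space error"
  unfolding cond_iv_def distr_error
proof (rule tendsto_eventually)
  show "\<forall>\<^sub>F c::real in at_top. (SUP i\<in>(UNIV :: nat set).
      \<integral>\<^sup>+ u. ennreal (u\<^sup>2) * indicator {u. \<bar>u\<bar> > c} u \<partial>skewed_law) = 0"
    \<comment> \<open>The errors are bounded by 2 in absolute value, so every tail integral is
      exactly 0 from \<open>c = 2\<close> on.\<close>
    using eventually_ge_at_top[of "2 :: real"]
    by eventually_elim (subst nn_integral_skewed_law, auto)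
qed

lemma regression_model_error:
  assumes "\<And>i. x i \<in> carrier_vec 1"
  shows "regression_model error_space 1 (0\<^sub>v 1) x error (sqrt 2)"
proof -
  interpret prob_space error_space
    by (rule prob_space_error_space)
  have mean: "expectation (error i) = 0" for i
    using integral_error(2)[of "\<lambda>u. u" i] by simp
  have "variance (error i) = (sqrt 2)\<^sup>2" for i
    unfolding mean using integral_error(2)[of "\<lambda>u. (u - 0)\<^sup>2" i] by simp
  then show ?thesis
    using assms mean indep_errors integral_error(1)[of "\<lambda>u. u"] integral_error(1)[of "\<lambda>u. u\<^sup>2"]
    by unfold_locales auto
qed

text \<open>Bounded, identically distributed errors turn the supremum of absolute moments into a
  single finite number, so one model serves every \<open>R\<close>.\<close>

lemma LM_dyadic: "LM R error_space 1 (0\<^sub>v 1) dyadic_design error (sqrt 2)"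
proof -
  have "(SUP i\<in>(UNIV :: nat set). \<integral>\<^sup>+ \<omega>. ennreal (\<bar>error i \<omega>\<bar> powr R) \<partial>error_space)
      = ennreal (2 powr R) * ennreal (1 / 3) + ennreal (2 / 3)"
    by (subst nn_integral_error[where f = "\<lambda>u. ennreal (\<bar>u\<bar> powr R)"]) auto
  then show ?thesis
    unfolding LM_def
    using dyadic_design_conditions cond_iv_error regression_model_error[of dyadic_design]
    by (auto simp: ennreal_mult_less_top)
qed

section \<open>Failure of the rate along the powers of two\<close>

text \<open>Exactly \<open>Suc k\<close> errors enter at this sample size, each adding 2 to the
  third moment of their sum, which is then divided by the cube of \<open>sqrt (Suc k)\<close>. The
  shift to \<open>Suc k\<close> excludes sample size 1, where the Gram entry is 0.\<close>

lemma third_moment_dyadic: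
  "(\<integral>\<omega>. xi 1 (0\<^sub>v 1) dyadic_design error (scale_mat 1 dyadic_design) (Matrix.vec 1 (\<lambda>_. 1)) (2 ^ Suc k) \<omega> ^ 3
      \<partial>error_space) = 2 / sqrt (real (Suc k))"
proof -
  interpret prob_space error_space
    by (rule prob_space_error_space)
  let ?m = "real (Suc k)" and ?X = "\<lambda>i \<omega>. dyadic_indicator i * error i \<omega>"
  have pow: "?X i \<omega> ^ j = dyadic_indicator i ^ j * error i \<omega> ^ j" for i j \<omega>
    by (rule power_mult_distrib)
  have "indep_vars (\<lambda>_. borel) ?X UNIV"
    by (rule indep_vars_compose2[OF indep_errors]) auto
  then have "indep_vars (\<lambda>_. borel) ?X {..<2 ^ Suc k}"
    by (rule indep_vars_subset) simp
  then have "expectation (\<lambda>\<omega>. (\<Sum>i<2 ^ Suc k. ?X i \<omega>) ^ 3)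
      = (\<Sum>i<2 ^ Suc k. expectation (\<lambda>\<omega>. ?X i \<omega> ^ 3))"
    using integral_error(1)[of "\<lambda>u. u ^ j" for j] integral_error(2)[of "\<lambda>u. u"]
    by (intro third_moment_sum[THEN conjunct2, THEN conjunct2]) (auto simp: pow)
  also have "\<dots> = (\<Sum>i<2 ^ Suc k. dyadic_indicator i * 2)"
    unfolding pow using integral_error(2)[of "\<lambda>u. u ^ 3"] by simp
  also have "\<dots> = ?m * 2"
    by (simp only: sum_distrib_right[symmetric] sum_dyadic_indicator)
  finally have S: "expectation (\<lambda>\<omega>. (\<Sum>i<2 ^ Suc k. ?X i \<omega>) ^ 3) = ?m * 2" .
  have m: "(\<Sum>i<2 ^ Suc k. (dyadic_indicator i)\<^sup>2) = ?m"
    using sum_dyadic_indicator[of "Suc k"] by simp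
  have "expectation (\<lambda>\<omega>. xi 1 (0\<^sub>v 1) dyadic_design error (scale_mat 1 dyadic_design)
      (Matrix.vec 1 (\<lambda>_. 1)) (2 ^ Suc k) \<omega> ^ 3)
      = expectation (\<lambda>\<omega>. (\<Sum>i<2 ^ Suc k. ?X i \<omega>) ^ 3 / sqrt ?m ^ 3)"
    using xi_scalar_design[of dyadic_indicator "2 ^ Suc k" error] by (simp only: m power_divide)
  also have "\<dots> = ?m * 2 / sqrt ?m ^ 3"
    using S by simp
  also have "\<dots> = 2 / sqrt ?m"
    by (simp add: power3_eq_cube del: of_nat_Suc)
  finally show ?thesis .
qed

text \<open>The law is symmetric about 0. In the degenerate case an odd \<open>r\<close> is
  positive, so \<open>0 ^ r\<close> is 0.\<close>

lemma centred_normal_odd_moment: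
  assumes "v \<ge> 0" and "odd r"
  shows "(\<integral>y. y ^ r \<partial>centred_normal v) = 0"
proof (cases "v = 0")
  case True
  then show ?thesis
    using odd_pos[OF \<open>odd r\<close>] by (simp add: centred_normal_def integral_return)
next
  case False
  obtain k where r: "r = 2 * k + 1"
    using \<open>odd r\<close> by (elim oddE)
  show ?thesis
    using False \<open>v \<ge> 0\<close> integral_normal_moment_odd[of "sqrt v" 0 k]
    by (simp add: centred_normal_def integral_density normal_density_nonneg r)
qed

text \<open>Allows the big-O bound, which concerns only sample sizes of full rank, to be restricted
  to this subsequence. The rank is full there because the row with index \<open>2 ^ k\<close> is
  among those observed.\<close>

lemma filterlim_power_full_rank_dyadic:
  "filterlim (\<lambda>k. 2 ^ Suc k) (full_rank_sequentially 1 dyadic_design) sequentially"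
proof -
  have "full_rank 1 dyadic_design (2 ^ Suc k)" for k
    by (rule full_rank_single_column[of "2 ^ k"]) (auto simp: dyadic_indicator_def)
  moreover have "filterlim (\<lambda>k. 2 ^ Suc k :: nat) sequentially sequentially"
    by real_asymp
  ultimately show ?thesis
    by (auto simp: full_rank_sequentially_def filterlim_inf filterlim_principal)
qed

lemma not_moment_rate_dyadic:
  assumes "a > 0"
  shows "\<not> moment_rate (\<lambda>n. real n powr (- a)) error_space 1 (0\<^sub>v 1) dyadic_design error (sqrt 2)
    (scale_mat 1 dyadic_design) (1\<^sub>m 1) (Matrix.vec 1 (\<lambda>_. 1)) 3"
proof
  assume "moment_rate (\<lambda>n. real n powr (- a)) error_space 1 (0\<^sub>v 1) dyadic_design error (sqrt 2)
    (scale_mat 1 dyadic_design) (1\<^sub>m 1) (Matrix.vec 1 (\<lambda>_. 1)) 3"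
  \<comment> \<open>Along the subsequence the moment difference is \<open>2 / sqrt (Suc k)\<close>,
    since the limit moment is 0, while the claimed bound decays geometrically in
    \<open>k\<close>.\<close>
  then have "(\<lambda>k. 2 / sqrt (real (Suc k))) \<in> O(\<lambda>k. real (2 ^ Suc k) powr (- a))"
    unfolding moment_rate_def
    by (drule_tac landau_o.big.compose[OF _ filterlim_power_full_rank_dyadic])
       (simp add: third_moment_dyadic[simplified] centred_normal_odd_moment scalar_prod_def)
  moreover have "(\<lambda>k. real (2 ^ Suc k) powr (- a)) \<in> o(\<lambda>k. 2 / sqrt (real (Suc k)))"
    using \<open>a > 0\<close> by real_asymp
  \<comment> \<open>A function that is little-o of itself is eventually 0.\<close>
  ultimately have "(\<lambda>k. 2 / sqrt (real (Suc k))) \<in> o(\<lambda>k. 2 / sqrt (real (Suc k)))"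
    by (rule landau_o.big_small_trans)
  then have "\<forall>\<^sub>F k in sequentially. 2 / sqrt (real (Suc k)) = 0"
    by (simp add: landau_o.small_refl_iff)
  then show False
    by simp
qed

theorem proposition2:
  fixes R :: real
  assumes "R > 3"
  shows "\<not> (\<exists>a::real. 0 < a \<and> a < 1/2 \<and>
    (\<forall>(M :: (nat \<Rightarrow> real) measure) p \<beta> x \<epsilon> \<sigma> \<Gamma> V \<alpha> r.
      LM R M p \<beta> x \<epsilon> \<sigma> \<longrightarrow> admissible M p x \<epsilon> \<Gamma> V \<longrightarrow> \<alpha> \<in> carrier_vec p \<longrightarrow>
      odd r \<longrightarrow> real r < R \<longrightarrow>
      moment_rate (\<lambda>n. real n powr (- a)) M p \<beta> x \<epsilon> \<sigma> \<Gamma> V \<alpha> r))"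
proof clarify
  fix a :: real
  assume "0 < a" and rate: "\<forall>(M :: (nat \<Rightarrow> real) measure) p \<beta> x \<epsilon> \<sigma> \<Gamma> V \<alpha> r.
      LM R M p \<beta> x \<epsilon> \<sigma> \<longrightarrow> admissible M p x \<epsilon> \<Gamma> V \<longrightarrow> \<alpha> \<in> carrier_vec p \<longrightarrow>
      odd r \<longrightarrow> real r < R \<longrightarrow>
      moment_rate (\<lambda>n. real n powr (- a)) M p \<beta> x \<epsilon> \<sigma> \<Gamma> V \<alpha> r"
  \<comment> \<open>The alternative through (i)-(iv) is taken: the Gram entry divided by
    \<open>n\<close> tends to 0 for this design, so (iii') is out of reach.\<close>
  have "admissible error_space 1 dyadic_design error (scale_mat 1 dyadic_design) (1\<^sub>m 1)"
    by (simp add: admissible_def dyadic_design_conditions[simplified] cond_iv_error)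
  then have "moment_rate (\<lambda>n. real n powr (- a)) error_space 1 (0\<^sub>v 1) dyadic_design error (sqrt 2)
      (scale_mat 1 dyadic_design) (1\<^sub>m 1) (Matrix.vec 1 (\<lambda>_. 1)) 3"
    \<comment> \<open>The assumption \<open>R > 3\<close> is what lets \<open>r = 3\<close> into the
      claimed range.\<close>
    using LM_dyadic[of R] \<open>R > 3\<close> by (intro rate[rule_format]) auto
  then show False
    using not_moment_rate_dyadic[OF \<open>0 < a\<close>] by contradiction
qed

end
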